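(* Let $T=(V,E)$ be a leafless directed tree with a root, let $\lambda=\{\lambda_v\}_{v\in V}$ be a sequence of positive numbers, let $1\le q<\infty$, and assume the backward shift $B$ is bounded on $\mathbf{L}^q(T,\lambda)$. If $B$ is hypercyclic, then for each $u\in V$ there exists an increasing sequence of natural numbers $\{n_k\}$ such that $$\sum_{v\in\operatorname{Chi}^{n_k}(u)}\lambda_v^{-1/q}\to\infty\qquad\text{as }k\to\infty .$$
   Context: A directed graph $T=(V,E)$ consists of a countably infinite set $V$ of vertices and a set $E\subseteq V\times V$ of directed edges; it is always assumed locally finite (every vertex has finite indegree and finite outdegree). $T$ is a directed tree if it has no directed circuits (including loops $(v,v)$), its underlying undirected graph is connected, and every vertex has indegree $0$ or $1$. A root is a vertex of indegree $0$ (there is at most one). A leaf is a vertex of outdegree $0$; leafless means having no leaf. If $v$ is not the root, its parent $\operatorname{par}(v)$ is the unique $u$ with $(u,v)\in E$; $\operatorname{par}^n$ denotes the $n$-fold iterate of $\operatorname{par}$, where defined. $\operatorname{Chi}(u)=\{v\in V:\operatorname{par}(v)=u\}$, and for $n\in\mathbb{N}=\{1,2,\dots\}$, $\operatorname{Chi}^n(u)=\{v\in V:\operatorname{par}^n(v)\text{ is defined and equals }u\}$. $\mathbf{L}^q(T,\lambda)$ is the complex Banach space of functions $f:V\to\mathbb{C}$ with $\|f\|_q=\big(\sum_{v\in V}|f(v)|^q\lambda_v\big)^{1/q}<\infty$. The backward shift $B$ is defined by $(Bf)(u)=\sum_{v\in\operatorname{Chi}(u)}f(v)$ for $u\in V$.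 A bounded operator $A$ on a Banach space $\mathcal{B}$ is hypercyclic if there is $x\in\mathcal{B}$ such that $\{A^nx: n=0,1,2,\dots\}$ is dense in $\mathcal{B}$. "Increasing" means strictly increasing. *)

theory Defs
  imports "HOL-Analysis.Analysis" "Graph_Theory.Graph_Theory"
begin

section \<open>Directed trees\<close>

text \<open>
  A directed graph with \<open>E \<subseteq> V \<times> V\<close> is a \<^typ>\<open>'a pair_pre_digraph\<close> satisfying
  \<^locale>\<open>pair_wf_digraph\<close>. The constant \<^const>\<open>tree\<close> says that the underlying undirected graph is
  connected and that there is no directed cycle; loops count as cycles. As \<^const>\<open>in_degree\<close> and
  \<^const>\<open>out_degree\<close> are cardinalities, which are \<open>0\<close> for infinite sets, local finiteness has to be
  required of the sets of arcs themselves.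
\<close>

locale directed_tree = pair_wf_digraph T for T :: "'a pair_pre_digraph" +
  assumes countable_verts: "countable (pverts T)"
    and infinite_verts: "infinite (pverts T)"
    and finite_in: "\<And>v. v \<in> pverts T \<Longrightarrow> finite (in_arcs T v)"
    and finite_out: "\<And>v. v \<in> pverts T \<Longrightarrow> finite (out_arcs T v)"
    and tree: "tree T"
    and in_degree_0_1: "\<And>v. v \<in> pverts T \<Longrightarrow> in_degree T v = 0 \<or> in_degree T v = 1"

definition is_root :: "'a pair_pre_digraph \<Rightarrow> 'a \<Rightarrow> bool" where
  "is_root T v \<longleftrightarrow> v \<in> pverts T \<and> in_degree T v = 0"

definition is_leaf :: "'a pair_pre_digraph \<Rightarrow> 'a \<Rightarrow> bool" where
  "is_leaf T v \<longleftrightarrow> v \<in> pverts T \<and> out_degree T v = 0"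

definition leafless :: "'a pair_pre_digraph \<Rightarrow> bool" where
  "leafless T \<longleftrightarrow> \<not> (\<exists>v. is_leaf T v)"

text \<open>The parent is a partial function: its value at the root is \<^term>\<open>None\<close>.\<close>

definition par :: "'a pair_pre_digraph \<Rightarrow> 'a \<Rightarrow> 'a option" where
  "par T v = (if \<exists>u. (u, v) \<in> parcs T then Some (THE u. (u, v) \<in> parcs T) else None)"

primrec par_iter :: "'a pair_pre_digraph \<Rightarrow> nat \<Rightarrow> 'a \<Rightarrow> 'a option" where
  "par_iter T 0 v = Some v"
| "par_iter T (Suc n) v = Option.bind (par_iter T n v) (par T)"

definition Chi :: "'a pair_pre_digraph \<Rightarrow> 'a \<Rightarrow> 'a set" where
  "Chi T u = {v \<in> pverts T. par T v = Some u}"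

definition Chi_iter :: "'a pair_pre_digraph \<Rightarrow> nat \<Rightarrow> 'a \<Rightarrow> 'a set" where
  "Chi_iter T n u = {v \<in> pverts T. par_iter T n v = Some u}"

lemma (in directed_tree) par_eq_Some_iff: "par T v = Some u \<longleftrightarrow> (u, v) \<in> parcs T"
proof -
  have "u = u'" if "(u, v) \<in> parcs T" "(u', v) \<in> parcs T" for u u'
  proof -
    have v: "v \<in> pverts T" using that in_arcsD2 by blast
    have "card (in_arcs T v) \<le> 1"
      using in_degree_0_1[OF v] by (auto simp: in_degree_def)
    moreover have "(u, v) \<in> in_arcs T v" "(u', v) \<in> in_arcs T v"
      using that by (auto simp: in_arcs_def)
    ultimately show ?thesis
      using finite_in[OF v] card_le_Suc0_iff_eq[of "in_arcs T v"] by fastforce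
  qed
  then show ?thesis
    unfolding par_def by (auto intro: the_equality theI2)
qed


section \<open>Operators on normed spaces of functions\<close>

text \<open>
  In the next two definitions \<open>X\<close> is a linear space of complex functions (with the pointwise
  operations) and \<open>N\<close> is a norm on \<open>X\<close>; density is density with respect to \<open>N\<close>.
\<close>

definition bounded_operator ::
  "('a \<Rightarrow> complex) set \<Rightarrow> (('a \<Rightarrow> complex) \<Rightarrow> real) \<Rightarrow> (('a \<Rightarrow> complex) \<Rightarrow> ('a \<Rightarrow> complex)) \<Rightarrow> bool" where
  "bounded_operator X N A \<longleftrightarrow>
     (\<forall>f\<in>X. A f \<in> X) \<and>
     (\<forall>f\<in>X. \<forall>g\<in>X. A (\<lambda>v. f v + g v) = (\<lambda>v. A f v + A g v)) \<and>
     (\<forall>c. \<forall>f\<in>X. A (\<lambda>v. c * f v) = (\<lambda>v. c * A f v)) \<and>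
     (\<exists>C. \<forall>f\<in>X. N (A f) \<le> C * N f)"

definition hypercyclic ::
  "('a \<Rightarrow> complex) set \<Rightarrow> (('a \<Rightarrow> complex) \<Rightarrow> real) \<Rightarrow> (('a \<Rightarrow> complex) \<Rightarrow> ('a \<Rightarrow> complex)) \<Rightarrow> bool" where
  "hypercyclic X N A \<longleftrightarrow>
     (\<exists>f\<in>X. \<forall>g\<in>X. \<forall>\<epsilon>>0. \<exists>n::nat. N (\<lambda>v. (A ^^ n) f v - g v) < \<epsilon>)"


section \<open>The weighted space and the backward shift\<close>

text \<open>
  A function \<open>V \<rightarrow> \<complex>\<close> is represented by its extension by \<open>0\<close> to the whole type.
\<close>

definition Lq_space :: "'a pair_pre_digraph \<Rightarrow> ('a \<Rightarrow> real) \<Rightarrow> real \<Rightarrow> ('a \<Rightarrow> complex) set" where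
  "Lq_space T lam q =
     {f. (\<forall>v. v \<notin> pverts T \<longrightarrow> f v = 0) \<and> (\<lambda>v. cmod (f v) powr q * lam v) summable_on pverts T}"

definition Lq_norm :: "'a pair_pre_digraph \<Rightarrow> ('a \<Rightarrow> real) \<Rightarrow> real \<Rightarrow> ('a \<Rightarrow> complex) \<Rightarrow> real" where
  "Lq_norm T lam q f = (\<Sum>\<^sub>\<infinity>v\<in>pverts T. cmod (f v) powr q * lam v) powr (1 / q)"

definition backward_shift :: "'a pair_pre_digraph \<Rightarrow> ('a \<Rightarrow> complex) \<Rightarrow> ('a \<Rightarrow> complex)" where
  "backward_shift T f = (\<lambda>u. \<Sum>v\<in>Chi T u. f v)"

text \<open>The shift respects the extension by \<open>0\<close>, because vertices outside of \<open>V\<close> have no children.\<close>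

lemma (in directed_tree) backward_shift_outside:
  "u \<notin> pverts T \<Longrightarrow> backward_shift T f u = 0"
  using in_arcsD1 by (auto simp: backward_shift_def Chi_def par_eq_Some_iff intro!: sum.neutral)

end

theory Submission
  imports Defs
begin

text \<open>
  If \<open>f\<close> is a hypercyclic vector, the orbit comes close to every multiple of the indicator function of
  \<open>u\<close>, so that the values \<open>(B\<^sup>n f)(u)\<close> are unbounded in \<open>n\<close>. On the other hand \<open>(B\<^sup>n f)(u)\<close> is the sum
  of \<open>f\<close> over the \<open>n\<close>-th generation below \<open>u\<close>, and point evaluation at \<open>v\<close> has norm
  \<open>\<lambda>\<^sub>v\<^bsup>-1/q\<^esup>\<close>; hence \<open>\<parallel>f\<parallel>\<close> times the sum in question dominates these values.
\<close>

text \<open>Finitely many initial values are bounded, so every bound is also exceeded at arbitrarily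
  late indices; choosing such indices recursively gives the subsequence.\<close>

lemma unbounded_imp_subseq_at_top:
  fixes S :: "nat \<Rightarrow> real"
  assumes unb: "\<And>K. \<exists>n. S n > K"
  shows "\<exists>n. strict_mono n \<and> (\<forall>k. n k \<ge> 1) \<and> filterlim (\<lambda>k. S (n k)) at_top sequentially"
proof -
  have late: "\<exists>n>m. S n > K" for m K
  proof -
    obtain n where n: "S n > Max (insert K (S ` {..m}))" using unb by blast
    then have "S n > K" "\<forall>i\<le>m. S n > S i" by auto
    then have "n > m" by (meson not_less order_less_irrefl)
    with \<open>S n > K\<close> show ?thesis by blast
  qed
  have "\<exists>n. \<forall>k. (n k \<ge> 1 \<and> S (n k) > real k) \<and> n k < n (Suc k)"
  proof (rule dependent_nat_choice)
    \<comment> \<open>Starting strictly after index 0 keeps all chosen indices positive.\<close>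
    show "\<exists>n. n \<ge> 1 \<and> S n > real 0" using late[of 0 0] by (auto simp: Suc_le_eq)
    show "\<exists>n'. (n' \<ge> 1 \<and> S n' > real (Suc k)) \<and> n < n'" for n k
      using late[where m = n and K = "real (Suc k)"]
      by (metis Suc_leI One_nat_def gr_implies_not0 neq0_conv)
  qed
  then obtain n where n: "\<And>k. n k \<ge> 1" "\<And>k. S (n k) > real k" "\<And>k. n k < n (Suc k)" by blast
  have "filterlim (\<lambda>k. S (n k)) at_top sequentially"
    by (rule filterlim_at_top_mono[OF filterlim_real_sequentially]) (simp add: n(2) less_imp_le)
  with n show ?thesis by (auto simp: strict_mono_Suc_iff)
qed

context directed_tree
begin

lemma Chi_eq: "Chi T u = {v. (u, v) \<in> parcs T}"
  using in_arcsD2 by (auto simp: Chi_def par_eq_Some_iff)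

lemma Chi_subset: "Chi T u \<subseteq> pverts T"
  by (auto simp: Chi_def)

lemma finite_Chi: "u \<in> pverts T \<Longrightarrow> finite (Chi T u)"
  by (rule finite_subset[OF _ finite_imageI[OF finite_out, of u snd]])
    (force simp: Chi_eq out_arcs_def)+

lemma Chi_iter_0: "u \<in> pverts T \<Longrightarrow> Chi_iter T 0 u = {u}"
  by (auto simp: Chi_iter_def)

text \<open>\<open>par_iter\<close> applies \<open>par\<close> last, so the n-th ancestor of a
  vertex in generation n + 1 is a child of \<open>u\<close>. This matches the outermost shift, which
  sums over children.\<close>

lemma Chi_iter_Suc: "Chi_iter T (Suc n) u = (\<Union>v\<in>Chi T u. Chi_iter T n v)"
  using in_arcsD2 by (auto simp: Chi_iter_def Chi_eq bind_eq_Some_conv par_eq_Some_iff)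

lemma finite_Chi_iter: "u \<in> pverts T \<Longrightarrow> finite (Chi_iter T n u)"
proof (induction n arbitrary: u)
  case 0
  then show ?case by (simp add: Chi_iter_0)
next
  case (Suc n)
  then show ?case using Chi_subset finite_Chi by (auto simp: Chi_iter_Suc)
qed

lemma backward_shift_funpow:
  "u \<in> pverts T \<Longrightarrow> (backward_shift T ^^ n) f u = (\<Sum>v\<in>Chi_iter T n u. f v)"
proof (induction n arbitrary: u)
  case 0
  then show ?case by (simp add: Chi_iter_0)
next
  case (Suc n)
  have "(\<Sum>w\<in>Chi_iter T (Suc n) u. f w) = (\<Sum>v\<in>Chi T u. \<Sum>w\<in>Chi_iter T n v. f w)"
    unfolding Chi_iter_Suc
  proof (rule sum.UNION_disjoint)
    show "\<forall>v\<in>Chi T u. finite (Chi_iter T n v)" using Chi_subset finite_Chi_iter by blast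
  \<comment> \<open>The generations below distinct children are disjoint because a vertex has at
    most one n-th ancestor.\<close>
  qed (use Suc.prems finite_Chi in \<open>auto simp: Chi_iter_def\<close>)
  also have "\<dots> = (\<Sum>v\<in>Chi T u. (backward_shift T ^^ n) f v)"
    using Suc.IH Chi_subset by (intro sum.cong) (auto simp: subset_iff)
  finally show ?case by (simp add: backward_shift_def[of T "(backward_shift T ^^ n) f"])
qed

end

lemma Lq_norm_nonneg: "Lq_norm T lam q f \<ge> 0"
  by (simp add: Lq_norm_def)

text \<open>A single nonnegative term is at most the whole sum; take q-th roots and divide by
  \<open>lam v powr (1 / q)\<close>.\<close>

lemma cmod_le_Lq_norm:
  assumes "f \<in> Lq_space T lam q" and v: "v \<in> pverts T" and q: "q > 0"
    and lam: "\<And>v. v \<in> pverts T \<Longrightarrow> lam v > 0"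
  shows "cmod (f v) \<le> Lq_norm T lam q f * lam v powr (- 1 / q)"
proof -
  have "(\<Sum>w\<in>{v}. cmod (f w) powr q * lam w) \<le> (\<Sum>\<^sub>\<infinity>w\<in>pverts T. cmod (f w) powr q * lam w)"
    using assms by (intro finite_sum_le_infsum) (auto simp: Lq_space_def less_imp_le)
  then have "(cmod (f v) powr q * lam v) powr (1 / q) \<le> Lq_norm T lam q f"
    unfolding Lq_norm_def using q lam[OF v] by (intro powr_mono2) auto
  then have "cmod (f v) * lam v powr (1 / q) \<le> Lq_norm T lam q f"
    using q lam[OF v] by (simp add: powr_mult powr_powr)
  then show ?thesis
    using lam[OF v] by (simp add: powr_minus field_simps)
qed

text \<open>Changing one value does not affect summability. This puts the difference of an orbit
  point and its target in the space without Minkowski's inequality.\<close>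

lemma Lq_space_minus_single:
  assumes "f \<in> Lq_space T lam q" and u: "u \<in> pverts T"
  shows "(\<lambda>v. f v - (if v = u then c else 0)) \<in> Lq_space T lam q"
proof -
  let ?g = "\<lambda>v. cmod (f v - (if v = u then c else 0)) powr q * lam v"
  have "(\<lambda>v. cmod (f v) powr q * lam v) summable_on (pverts T - {u})"
    using assms by (auto simp: Lq_space_def intro: summable_on_subset_banach)
  then have "?g summable_on (pverts T - {u})"
    by (rule summable_on_cong[THEN iffD1, rotated]) auto
  then have "?g summable_on ((pverts T - {u}) \<union> {u})"
    by (intro summable_on_Un_disjoint) auto
  moreover have "(pverts T - {u}) \<union> {u} = pverts T" using u by blast
  ultimately show ?thesis using assms by (auto simp: Lq_space_def)
qed

lemma single_in_Lq_space:
  "u \<in> pverts T \<Longrightarrow> (\<lambda>v. if v = u then c else 0) \<in> Lq_space T lam q"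
  \<comment> \<open>The function is zero minus \<open>- c\<close> times the indicator of
    \<open>u\<close>.\<close>
  using Lq_space_minus_single[of "\<lambda>_. 0" T lam q u "- c"]
  by (simp add: Lq_space_def if_distrib cong: if_cong)

theorem theorem5p4:
  fixes T :: "'a pair_pre_digraph" and lam :: "'a \<Rightarrow> real" and q :: real
  assumes "directed_tree T"
    and "leafless T"
    and "\<exists>r. is_root T r"
    and "\<And>v. v \<in> pverts T \<Longrightarrow> lam v > 0"
    and "1 \<le> q"
    and "bounded_operator (Lq_space T lam q) (Lq_norm T lam q) (backward_shift T)"
    and "hypercyclic (Lq_space T lam q) (Lq_norm T lam q) (backward_shift T)"
  shows "\<forall>u\<in>pverts T. \<exists>n :: nat \<Rightarrow> nat. strict_mono n \<and> (\<forall>k. n k \<ge> 1) \<and>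
    filterlim (\<lambda>k. \<Sum>v\<in>Chi_iter T (n k) u. lam v powr (- 1 / q)) at_top sequentially"
proof
  interpret directed_tree T by fact
  let ?X = "Lq_space T lam q" and ?N = "Lq_norm T lam q" and ?B = "backward_shift T"
  fix u assume u: "u \<in> pverts T"
  define S where "S n = (\<Sum>v\<in>Chi_iter T n u. lam v powr (- 1 / q))" for n
  define c where "c = lam u powr (- 1 / q)"
  have q: "q > 0" using \<open>1 \<le> q\<close> by simp
  note eval = cmod_le_Lq_norm[OF _ _ q assms(4)]
  obtain f where f: "f \<in> ?X"
    and dense: "\<And>g \<epsilon>. g \<in> ?X \<Longrightarrow> \<epsilon> > 0 \<Longrightarrow> \<exists>n. ?N (\<lambda>v. (?B ^^ n) f v - g v) < \<epsilon>"
    using assms(7) unfolding hypercyclic_def by blast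
  have orbit: "(?B ^^ n) f \<in> ?X" for n
    using f assms(6) by (induction n) (auto simp: bounded_operator_def)
  have upper: "cmod ((?B ^^ n) f u) \<le> ?N f * S n" for n
    unfolding backward_shift_funpow[OF u] S_def sum_distrib_left
    by (intro order_trans[OF norm_sum] sum_mono eval f) (simp_all add: Chi_iter_def)
  have lower: "\<exists>n. cmod ((?B ^^ n) f u) \<ge> M - c" for M :: real
  proof -
    \<comment> \<open>An orbit point within norm distance 1 of \<open>?g\<close> has a value at
      \<open>u\<close> within \<open>c\<close> of \<open>M\<close>, since evaluation at
      \<open>u\<close> costs the factor \<open>c\<close>.\<close>
    let ?g = "\<lambda>v. if v = u then complex_of_real M else 0"
    obtain n where n: "?N (\<lambda>v. (?B ^^ n) f v - ?g v) < 1"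
      using dense[OF single_in_Lq_space[OF u] zero_less_one] by blast
    have "cmod ((?B ^^ n) f u - M) \<le> ?N (\<lambda>v. (?B ^^ n) f v - ?g v) * c"
      using eval[OF Lq_space_minus_single[OF orbit u] u, of n M] by (simp add: c_def)
    also have "\<dots> \<le> 1 * c"
      using n by (intro mult_right_mono) (auto simp: c_def)
    finally have "cmod ((?B ^^ n) f u - M) \<le> c" by simp
    moreover have "M \<le> cmod (complex_of_real M)" by simp
    ultimately show ?thesis
      using norm_triangle_ineq2[of "complex_of_real M" "(?B ^^ n) f u"]
      by (intro exI[of _ n]) (simp add: norm_minus_commute)
  qed
  have "\<exists>n. S n > K" for K
  proof (rule ccontr)
    assume "\<nexists>n. S n > K"
    \<comment> \<open>Multiplying by the norm, instead of dividing by it, also covers norm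
      zero.\<close>
    then have K: "?N f * S n \<le> ?N f * K" for n
      by (intro mult_left_mono Lq_norm_nonneg) (simp add: not_less)
    \<comment> \<open>The target height is chosen so that, after losing \<open>c\<close>, the value
      still exceeds the supposed bound \<open>?N f * K\<close> by 1.\<close>
    obtain n where "cmod ((?B ^^ n) f u) \<ge> (?N f * K + c + 1) - c" using lower by blast
    with upper[of n] K[of n] show False by simp
  qed
  then show "\<exists>n :: nat \<Rightarrow> nat. strict_mono n \<and> (\<forall>k. n k \<ge> 1) \<and>
      filterlim (\<lambda>k. \<Sum>v\<in>Chi_iter T (n k) u. lam v powr (- 1 / q)) at_top sequentially"
    using unbounded_imp_subseq_at_top[of S] unfolding S_def by blast
qed

end
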